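(* Assume $\mathcal{D}\cap\mathcal{T}=\emptyset$, $\mathcal{D}\cap\mathcal{B}=\emptyset$ and $\mathcal{T}\cap\mathcal{C}=\emptyset$, and let $m=|\mathcal{B}|$, $p=|\mathcal{C}|$. Let $\mathcal{W}$ be an $(A,B)$- and $(C,A)$-invariant set of nodes. If $\mathcal{C}=\partial_-(\mathcal{W},A)$ and $\mathcal{B}=\partial_+(\mathcal{W},A)$, then the unique friend of $\mathcal{W}$, i.e. the unique matrix $G\in\mathbb{R}^{m\times p}$ such that $(A-BGC)\mathcal{W}\subseteq\mathcal{W}$, is $G=B^\top AC^\top$ (and it solves the DDPOF when $\mathcal{D}\subseteq\mathcal{W}\subseteq\mathcal{V}\setminus\mathcal{T}$).
   Context: Let $(\mathcal{V},\mathcal{E},A)$ be a digraph with $\mathcal{V}=\{v_1,\dots,v_n\}$, where $(v_i,v_j)\in\mathcal{E}$ means $v_i\to v_j$, and $A\in\mathbb{R}^{n\times n}$ has $A_{ji}\ne0$ if and only if $(v_i,v_j)\in\mathcal{E}$. $\mathcal{B},\mathcal{C},\mathcal{D},\mathcal{T}\subseteq\mathcal{V}$ are the sets of input, output, disturbance and target nodes of the system $\dot x=Ax+Bu+Dw$, $y=Cx$, $z=Tx$. The columns of $B$ (resp. $D$) are the canonical vectors $e_i$ with $v_i\in\mathcal{B}$ (resp. $\mathcal{D}$); the rows of $C$ (resp. $T$) are the $e_i^\top$ with $v_i\in\mathcal{C}$ (resp. $\mathcal{T}$). A node set is identified with the subspace of $\mathbb{R}^n$ spanned by the corresponding canonical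 vectors. $\mathcal{W}$ is $(A,B)$-invariant if $A\mathcal{W}\subseteq\mathcal{W}+\mathcal{B}$, and $(C,A)$-invariant if $A(\mathcal{W}\setminus\mathcal{C})\subseteq\mathcal{W}$. $G$ solves the DDPOF (output feedback $u=-Gy$) if $T(sI-A+BGC)^{-1}D=0$ for all $s$ (as a rational matrix identity). In-boundary: $\partial_-(\mathcal{W},A)=\{v_i\in\mathcal{W}:\exists\,(v_i,v_j)\in\mathcal{E},\ v_j\notin\mathcal{W}\}$. Out-boundary: $\partial_+(\mathcal{W},A)=\{v_j\notin\mathcal{W}:\exists\,(v_i,v_j)\in\mathcal{E},\ v_i\in\mathcal{W}\}$. *)

theory Defs
  imports
    "HOL-Computational_Algebra.Polynomial_Factorial"
    "Jordan_Normal_Form.VS_Connect"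
    "Jordan_Normal_Form.Gauss_Jordan_Elimination"
begin

text \<open>
  The node \<open>v\<^sub>i\<^sub>+\<^sub>1\<close> is represented by its index \<open>i < n\<close>, so that node \<open>i\<close>
  corresponds to row and column \<open>i\<close> of the matrices. Edges are pairs of indices; note the
  transposition between the edge \<open>i \<rightarrow> j\<close> and the entry of \<open>A\<close> in row \<open>j\<close> and column \<open>i\<close>.
\<close>

definition weighted_digraph :: "nat \<Rightarrow> (nat \<times> nat) set \<Rightarrow> real mat \<Rightarrow> bool" where
  "weighted_digraph n E A \<longleftrightarrow>
     E \<subseteq> {..<n} \<times> {..<n} \<and> A \<in> carrier_mat n n \<and>
     (\<forall>i<n. \<forall>j<n. A $$ (j, i) \<noteq> 0 \<longleftrightarrow> (i, j) \<in> E)"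

text \<open>
  The columns (rows) are the canonical vectors of the nodes in \<open>X\<close>, each occurring exactly once;
  their order is not prescribed.
\<close>

definition canonical_cols :: "nat \<Rightarrow> nat set \<Rightarrow> real mat \<Rightarrow> bool" where
  "canonical_cols n X M \<longleftrightarrow>
     M \<in> carrier_mat n (card X) \<and> distinct (cols M) \<and> set (cols M) = unit_vec n ` X"

definition canonical_rows :: "nat \<Rightarrow> nat set \<Rightarrow> real mat \<Rightarrow> bool" where
  "canonical_rows n X M \<longleftrightarrow>
     M \<in> carrier_mat (card X) n \<and> distinct (rows M) \<and> set (rows M) = unit_vec n ` X"

definition node_space :: "nat \<Rightarrow> nat set \<Rightarrow> real vec set" where
  "node_space n X =
     LinearCombinations.module.span class_ring (module_vec TYPE(real) n) (unit_vec n ` X)"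

definition AB_invariant :: "nat \<Rightarrow> real mat \<Rightarrow> nat set \<Rightarrow> nat set \<Rightarrow> bool" where
  "AB_invariant n A \<B> \<W> \<longleftrightarrow>
     (\<lambda>x. A *\<^sub>v x) ` node_space n \<W> \<subseteq> {w + b | w b. w \<in> node_space n \<W> \<and> b \<in> node_space n \<B>}"

text \<open>
  The set difference is taken between node sets: the subspace spanned by \<open>\<W> - \<C>\<close> is the
  intersection of the subspace spanned by \<open>\<W>\<close> with the kernel of the output matrix.
\<close>

definition CA_invariant :: "nat \<Rightarrow> nat set \<Rightarrow> real mat \<Rightarrow> nat set \<Rightarrow> bool" where
  "CA_invariant n \<C> A \<W> \<longleftrightarrow>
     (\<lambda>x. A *\<^sub>v x) ` node_space n (\<W> - \<C>) \<subseteq> node_space n \<W>"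

definition in_boundary :: "(nat \<times> nat) set \<Rightarrow> nat set \<Rightarrow> nat set" where
  "in_boundary E \<W> = {i \<in> \<W>. \<exists>j. (i, j) \<in> E \<and> j \<notin> \<W>}"

definition out_boundary :: "(nat \<times> nat) set \<Rightarrow> nat set \<Rightarrow> nat set" where
  "out_boundary E \<W> = {j. j \<notin> \<W> \<and> (\<exists>i. (i, j) \<in> E \<and> i \<in> \<W>)}"

definition is_friend ::
  "nat \<Rightarrow> nat \<Rightarrow> nat \<Rightarrow> real mat \<Rightarrow> real mat \<Rightarrow> real mat \<Rightarrow> nat set \<Rightarrow> real mat \<Rightarrow> bool" where
  "is_friend n m p A B C \<W> G \<longleftrightarrow>
     G \<in> carrier_mat m p \<and>
     (\<lambda>x. (A - B * G * C) *\<^sub>v x) ` node_space n \<W> \<subseteq> node_space n \<W>"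

text \<open>
  Transfer matrices live over the field \<open>\<real>(s)\<close> of rational functions, so the vanishing of the
  closed-loop transfer matrix is an identity between rational matrices.
\<close>

definition rat_mat :: "real mat \<Rightarrow> real poly fract mat" where
  "rat_mat M = map_mat (\<lambda>a. to_fract [:a:]) M"

definition rat_s :: "real poly fract" where
  "rat_s = to_fract [:0, 1:]"

definition solves_DDPOF ::
  "nat \<Rightarrow> real mat \<Rightarrow> real mat \<Rightarrow> real mat \<Rightarrow> real mat \<Rightarrow> real mat \<Rightarrow> real mat \<Rightarrow> bool" where
  "solves_DDPOF n A B C D T G \<longleftrightarrow>
     (\<exists>R. mat_inverse (rat_s \<cdot>\<^sub>m 1\<^sub>m n - rat_mat A + rat_mat B * rat_mat G * rat_mat C) = Some R \<and>
          rat_mat T * R * rat_mat D = 0\<^sub>m (dim_row T) (dim_col D))"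

end

theory Submission
  imports Defs "Jordan_Normal_Form.Char_Poly"
begin

text \<open>
  A matrix maps the coordinate subspace of \<open>\<W>\<close> into itself exactly when its entries in the rows
  outside \<open>\<W>\<close> and the columns in \<open>\<W>\<close> vanish. For \<open>A - B G C\<close> these entries concern the edges that
  leave \<open>\<W>\<close>. All of them start in the in-boundary \<open>\<C>\<close> and end in the out-boundary \<open>\<B>\<close>. On the
  block of rows \<open>\<B>\<close> and columns \<open>\<C>\<close>, the matrix \<open>B G C\<close> is a copy of \<open>G\<close>, and it vanishes
  elsewhere. So \<open>G\<close> must cancel the block of \<open>A\<close> with these rows and columns, which is
  \<open>B\<^sup>T A C\<^sup>T\<close>, and this cancels every edge leaving \<open>\<W>\<close>. The lemmas \<open>mat_maps_node_space_iff\<close>,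
  \<open>canonical_cols_enum\<close> and \<open>sandwich_unit\<close> carry this part.

  For the decoupling, the closed loop \<open>M = A - B G C\<close> leaves \<open>\<W>\<close> invariant, and hence so does the
  inverse of \<open>s I - M\<close> over \<open>\<real>(s)\<close> (\<open>resolvent_entry_zero\<close>). The columns of \<open>D\<close> lie in \<open>\<W>\<close> and
  the rows of \<open>T\<close> read off coordinates outside \<open>\<W>\<close>, so the transfer matrix is zero.
\<close>

section \<open>Coordinate subspaces\<close>

lemma node_space_eq:
  assumes X: "X \<subseteq> {..<n}"
  shows "node_space n X = {v \<in> carrier_vec n. \<forall>i<n. i \<notin> X \<longrightarrow> v $ i = 0}"
proof -
  interpret vec_space "TYPE(real)" n .
  let ?U = "unit_vec n ` X :: real vec set"
  have fin: "finite X" using X finite_subset by blast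
  have U: "?U \<subseteq> carrier_vec n" by auto
  have dim: "dim_vec (lincomb a ?U) = n" for a using fin U by (intro lincomb_dim) auto
  have inj: "inj_on (unit_vec n :: nat \<Rightarrow> real vec) X"
    using X by (auto simp: inj_on_def dest!: subsetD)
  have span: "node_space n X = {lincomb a ?U | a. a \<in> ?U \<rightarrow> UNIV}"
    unfolding node_space_def using finite_span[of ?U] fin U by simp
  have idx: "lincomb a ?U $ j = (if j \<in> X then a (unit_vec n j) else 0)" if j: "j < n" for a j
  proof -
    have "lincomb a ?U $ j = (\<Sum>i\<in>X. a (unit_vec n i) * unit_vec n i $ j)"
      using lincomb_index[OF j U] by (simp add: sum.reindex[OF inj])
    also have "\<dots> = (\<Sum>i\<in>X. if i = j then a (unit_vec n j) else 0)"
      using X j by (intro sum.cong) auto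
    finally show ?thesis using fin by simp
  qed
  show ?thesis
  proof (intro equalityI subsetI)
    fix v assume "v \<in> node_space n X"
    then obtain a where "v = lincomb a ?U" using span by auto
    then show "v \<in> {v \<in> carrier_vec n. \<forall>i<n. i \<notin> X \<longrightarrow> v $ i = 0}"
      using idx U fin by (auto intro!: lincomb_closed)
  next
    fix v :: "real vec" assume v: "v \<in> {v \<in> carrier_vec n. \<forall>i<n. i \<notin> X \<longrightarrow> v $ i = 0}"
    have "v = lincomb (\<lambda>u. u \<bullet> v) ?U"
    proof (rule eq_vecI)
      show "dim_vec v = dim_vec (lincomb (\<lambda>u. u \<bullet> v) ?U)"
        using v dim by auto
      show "v $ j = lincomb (\<lambda>u. u \<bullet> v) ?U $ j" if "j < dim_vec (lincomb (\<lambda>u. u \<bullet> v) ?U)" for j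
        using that v dim idx[of j] by auto
    qed
    then show "v \<in> node_space n X" using span by blast
  qed
qed

lemma mat_mult_unit_vec:
  assumes "M \<in> carrier_mat m n" "i < n"
  shows "M *\<^sub>v unit_vec n i = (col M i :: 'a :: semiring_1 vec)"
  using assms by (intro eq_vecI) auto

lemma mat_maps_node_space_iff:
  assumes M: "M \<in> carrier_mat n n" and X: "X \<subseteq> {..<n}"
  shows "(\<lambda>x. M *\<^sub>v x) ` node_space n X \<subseteq> node_space n X
    \<longleftrightarrow> (\<forall>i\<in>X. \<forall>j<n. j \<notin> X \<longrightarrow> M $$ (j, i) = 0)"
proof (intro iffI ballI allI impI)
  fix i j assume sub: "(\<lambda>x. M *\<^sub>v x) ` node_space n X \<subseteq> node_space n X"
    and i: "i \<in> X" and j: "j < n" "j \<notin> X"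
  have "unit_vec n i \<in> node_space n X" using i X by (auto simp: node_space_eq[OF X])
  then have "M *\<^sub>v unit_vec n i \<in> node_space n X" using sub by blast
  then show "M $$ (j, i) = 0"
    using i j X M by (auto simp: node_space_eq[OF X] mat_mult_unit_vec[OF M])
next
  assume zero: "\<forall>i\<in>X. \<forall>j<n. j \<notin> X \<longrightarrow> M $$ (j, i) = 0"
  show "(\<lambda>x. M *\<^sub>v x) ` node_space n X \<subseteq> node_space n X"
  proof clarify
    fix x assume x: "x \<in> node_space n X"
    have "(M *\<^sub>v x) $ j = 0" if j: "j < n" "j \<notin> X" for j
    proof -
      have "(M *\<^sub>v x) $ j = (\<Sum>i\<in>{0..<n}. M $$ (j, i) * x $ i)"
        using M j x by (auto simp: node_space_eq[OF X] scalar_prod_def)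
      also have "\<dots> = 0"
        using zero x j by (intro sum.neutral) (auto simp: node_space_eq[OF X])
      finally show ?thesis .
    qed
    then show "M *\<^sub>v x \<in> node_space n X"
      using M x by (auto simp: node_space_eq[OF X])
  qed
qed

section \<open>Selection matrices\<close>

text \<open>
  The enumeration of the node set by the columns need not be increasing. Read along its rows, the
  same matrix has unit vectors at the nodes of the set and zero rows elsewhere; both readings
  are used, the first in \<open>B\<^sup>T A C\<^sup>T\<close> and the second in \<open>B G C\<close>.
\<close>

lemma canonical_cols_enum:
  assumes M: "canonical_cols n X M" and X: "X \<subseteq> {..<n}"
  obtains \<beta> where "bij_betw \<beta> {..<card X} X"
    and "\<And>k. k < card X \<Longrightarrow> col M k = unit_vec n (\<beta> k)"
    and "\<And>k. k < card X \<Longrightarrow> row M (\<beta> k) = unit_vec (card X) k"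
    and "\<And>j. j < n \<Longrightarrow> j \<notin> X \<Longrightarrow> row M j = 0\<^sub>v (card X)"
proof -
  let ?e = "unit_vec n :: nat \<Rightarrow> real vec"
  have car: "M \<in> carrier_mat n (card X)" and dist: "distinct (cols M)"
    and set: "set (cols M) = ?e ` X"
    using M unfolding canonical_cols_def by auto
  have inj: "inj_on ?e X"
    using X by (auto simp: inj_on_def dest!: subsetD)
  define \<beta> where "\<beta> = inv_into X ?e \<circ> (!) (cols M)"
  have "bij_betw ((!) (cols M)) {..<card X} (?e ` X)"
    using dist set car by (intro bij_betw_nth) auto
  then have bij: "bij_betw \<beta> {..<card X} X"
    unfolding \<beta>_def using inj by (blast intro: bij_betw_trans bij_betw_inv_into inj_on_imp_bij_betw)
  have col: "col M k = ?e (\<beta> k)" if k: "k < card X" for k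
  proof -
    have "cols M ! k \<in> ?e ` X" using k car set by (metis carrier_matD(2) cols_length nth_mem)
    then have "?e (\<beta> k) = cols M ! k" unfolding \<beta>_def by (simp add: f_inv_into_f)
    then show ?thesis using k car by simp
  qed
  have in_X: "\<beta> k \<in> X" "\<beta> k < n" if "k < card X" for k
    using bij_betwE[OF bij] that X by auto
  have entry: "M $$ (j, k) = (if j = \<beta> k then 1 else 0)" if "j < n" "k < card X" for j k
  proof -
    have "M $$ (j, k) = col M k $ j" using that car by simp
    then show ?thesis using that in_X col by simp
  qed
  have "row M (\<beta> k) = unit_vec (card X) k" if k: "k < card X" for k
  proof (rule eq_vecI)
    fix l assume "l < dim_vec (unit_vec (card X) k :: real vec)"
    then have l: "l < card X" by simp
    have "\<beta> k = \<beta> l \<longleftrightarrow> l = k" using bij k l by (auto simp: bij_betw_def inj_on_def)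
    then show "row M (\<beta> k) $ l = unit_vec (card X) k $ l"
      using k l in_X[OF k] car entry by simp
  qed (use car in simp)
  moreover have "row M j = 0\<^sub>v (card X)" if "j < n" "j \<notin> X" for j
    using that car entry in_X by (intro eq_vecI) auto
  ultimately show ?thesis using that bij col by blast
qed

lemma canonical_rows_transpose:
  "canonical_rows n X M \<Longrightarrow> canonical_cols n X (transpose_mat M)"
  by (auto simp: canonical_rows_def canonical_cols_def)

lemma sandwich_entry:
  fixes P G Q :: "'a :: semiring_1 mat"
  assumes "P \<in> carrier_mat a b" "G \<in> carrier_mat b c" "Q \<in> carrier_mat c d" "j < a" "i < d"
  shows "(P * G * Q) $$ (j, i) = row P j \<bullet> (G *\<^sub>v col Q i)"
proof -
  have "P * G * Q = P * (G * Q)" using assms by (simp add: assoc_mult_mat)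
  also have "\<dots> $$ (j, i) = row P j \<bullet> col (G * Q) i"
    using assms by (intro index_mult_mat(1)) auto
  also have "col (G * Q) i = G *\<^sub>v col Q i"
    using assms(2,3,5) by (rule col_mult2)
  finally show ?thesis .
qed

lemma sandwich_unit:
  fixes P G Q :: "'a :: semiring_1 mat"
  assumes "P \<in> carrier_mat a b" "G \<in> carrier_mat b c" "Q \<in> carrier_mat c d" "j < a" "i < d"
    and "row P j = unit_vec b k" "k < b" and "col Q i = unit_vec c l" "l < c"
  shows "(P * G * Q) $$ (j, i) = G $$ (k, l)"
proof -
  have "(P * G * Q) $$ (j, i) = unit_vec b k \<bullet> col G l"
    unfolding sandwich_entry[OF assms(1-5)] assms(6,8) mat_mult_unit_vec[OF assms(2,9)] ..
  also have "\<dots> = col G l $ k"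
    using assms(2,7) by (intro scalar_prod_left_unit) auto
  finally show ?thesis using assms(2,7,9) by simp
qed

lemma sandwich_zero:
  fixes P G Q :: "'a :: semiring_1 mat"
  assumes "P \<in> carrier_mat a b" "G \<in> carrier_mat b c" "Q \<in> carrier_mat c d" "j < a" "i < d"
    and "row P j = 0\<^sub>v b \<or> col Q i = 0\<^sub>v c"
  shows "(P * G * Q) $$ (j, i) = 0"
proof -
  have G0: "G *\<^sub>v 0\<^sub>v c = 0\<^sub>v b" using assms(2) by (intro eq_vecI) auto
  have "G *\<^sub>v col Q i \<in> carrier_vec b" "row P j \<in> carrier_vec b" using assms(1-4) by auto
  then have "row P j \<bullet> (G *\<^sub>v col Q i) = 0"
    using assms(6) G0 by (metis scalar_prod_left_zero scalar_prod_right_zero)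
  then show ?thesis unfolding sandwich_entry[OF assms(1-5)] .
qed

section \<open>The resolvent over the rational functions\<close>

lemma rat_mat_carrier [simp]: "rat_mat M \<in> carrier_mat a b \<longleftrightarrow> M \<in> carrier_mat a b"
  by (auto simp: rat_mat_def)

lemma rat_mat_dim [simp]: "dim_row (rat_mat M) = dim_row M" "dim_col (rat_mat M) = dim_col M"
  by (auto simp: rat_mat_def)

lemma rat_mat_mult:
  assumes "P \<in> carrier_mat a b" "Q \<in> carrier_mat b c"
  shows "rat_mat (P * Q) = rat_mat P * rat_mat Q"
proof -
  interpret semiring_hom "\<lambda>x :: real. to_fract [:x:]"
    by unfold_locales (auto simp flip: to_fract_add to_fract_mult one_pCons)
  show ?thesis unfolding rat_mat_def using assms by (rule mat_hom_mult)
qed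

lemma rat_mat_col_unit:
  assumes "col M k = unit_vec n i" "M \<in> carrier_mat n c" "k < c" "i < n"
  shows "col (rat_mat M) k = unit_vec n i"
proof (rule eq_vecI)
  fix j assume "j < dim_vec (unit_vec n i :: real poly fract vec)"
  then have j: "j < n" by simp
  have "M $$ (j, k) = unit_vec n i $ j" using assms j by (metis carrier_matD index_col)
  then show "col (rat_mat M) k $ j = unit_vec n i $ j"
    using assms j by (simp add: rat_mat_def flip: one_pCons)
qed (use assms in simp)

text \<open>
  The determinant of \<open>s I - M\<close> is the characteristic polynomial, which is monic and thus nonzero:
  the indeterminate \<open>s\<close> is never an eigenvalue of a real matrix.
\<close>

lemma det_resolvent_nonzero:
  assumes M: "M \<in> carrier_mat n n"
  shows "det (rat_s \<cdot>\<^sub>m 1\<^sub>m n - rat_mat M) \<noteq> 0"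
proof -
  interpret comm_ring_hom "to_fract :: real poly \<Rightarrow> real poly fract"
    by unfold_locales auto
  have "rat_s \<cdot>\<^sub>m 1\<^sub>m n - rat_mat M = map_mat to_fract (char_poly_matrix M)"
    using M by (intro eq_matI)
      (auto simp: rat_mat_def rat_s_def char_poly_matrix_def simp flip: to_fract_diff to_fract_uminus)
  then have "det (rat_s \<cdot>\<^sub>m 1\<^sub>m n - rat_mat M) = to_fract (char_poly M)"
    by (simp add: char_poly_def)
  moreover have "char_poly M \<noteq> 0"
    using degree_monic_char_poly[OF M] by auto
  ultimately show ?thesis by simp
qed

lemma mat_inverse_exists:
  fixes N :: "'a :: field mat"
  assumes N: "N \<in> carrier_mat n n" and det: "det N \<noteq> 0"
  obtains R where "mat_inverse N = Some R" "N * R = 1\<^sub>m n" "R \<in> carrier_mat n n"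
proof -
  have "N \<in> Units (ring_mat TYPE('a) n ())" by (rule det_non_zero_imp_unit[OF N det])
  then have "mat_inverse N \<noteq> None" using mat_inverse(1)[OF N, where b = "()"] by blast
  then obtain R where R: "mat_inverse N = Some R" by blast
  then show ?thesis using that mat_inverse(2)[OF N R] by blast
qed

text \<open>
  Let \<open>x\<close> be the column of \<open>R\<close> at the node \<open>i \<in> \<W>\<close> and \<open>y\<close> its part outside \<open>\<W>\<close>. Since \<open>M\<close> has no
  entries from \<open>\<W>\<close> to the complement, the rows of \<open>(s I - M) x = e\<^sub>i\<close> outside \<open>\<W>\<close> read
  \<open>(s I - M') y = 0\<close>, where \<open>M'\<close> is the block of \<open>M\<close> on the complement of \<open>\<W>\<close>, padded with zeros
  to keep the dimension. As \<open>s\<close> is not an eigenvalue of \<open>M'\<close> either, \<open>y = 0\<close>.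
\<close>

lemma resolvent_entry_zero:
  assumes M: "M \<in> carrier_mat n n"
    and inv: "\<And>i j. i \<in> \<W> \<Longrightarrow> j < n \<Longrightarrow> j \<notin> \<W> \<Longrightarrow> M $$ (j, i) = 0"
    and R: "R \<in> carrier_mat n n" "(rat_s \<cdot>\<^sub>m 1\<^sub>m n - rat_mat M) * R = 1\<^sub>m n"
    and ij: "i \<in> \<W>" "i < n" "j < n" "j \<notin> \<W>"
  shows "R $$ (j, i) = 0"
proof -
  define M' where "M' = mat n n (\<lambda>(j, k). if j \<in> \<W> \<or> k \<in> \<W> then 0 else M $$ (j, k))"
  define y where "y = vec n (\<lambda>j. if j \<in> \<W> then 0 else R $$ (j, i))"
  let ?N = "rat_s \<cdot>\<^sub>m 1\<^sub>m n - rat_mat M" and ?N' = "rat_s \<cdot>\<^sub>m 1\<^sub>m n - rat_mat M'"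
  have M': "M' \<in> carrier_mat n n" unfolding M'_def by simp
  have N': "?N' \<in> carrier_mat n n" using M' by (simp add: minus_carrier_mat)
  have y_carrier: "y \<in> carrier_vec n" by (simp add: y_def)
  have "?N' *\<^sub>v y = 0\<^sub>v n"
  proof (rule eq_vecI)
    fix r assume "r < dim_vec (0\<^sub>v n :: real poly fract vec)"
    then have r: "r < n" by simp
    have eq: "(?N' *\<^sub>v y) $ r = (\<Sum>k\<in>{0..<n}. ?N' $$ (r, k) * y $ k)"
      using r M' by (auto simp: scalar_prod_def y_def)
    show "(?N' *\<^sub>v y) $ r = 0\<^sub>v n $ r"
    proof (cases "r \<in> \<W>")
      case True
      then have "?N' $$ (r, k) * y $ k = 0" if "k < n" for k
        using r that by (auto simp: y_def M'_def rat_mat_def)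
      then show ?thesis unfolding eq using r by (simp add: sum.neutral)
    next
      case False
      have "?N' $$ (r, k) * y $ k = ?N $$ (r, k) * R $$ (k, i)" if k: "k < n" for k
        using r k False M inv[of k r] by (auto simp: y_def M'_def rat_mat_def)
      then have "(?N' *\<^sub>v y) $ r = (\<Sum>k\<in>{0..<n}. ?N $$ (r, k) * R $$ (k, i))"
        using eq by simp
      also have "\<dots> = (?N * R) $$ (r, i)"
        using r ij M R(1) by (auto simp: scalar_prod_def)
      also have "\<dots> = 0" using R(2) r ij False by auto
      finally show ?thesis using r by simp
    qed
  qed (use M' in simp)
  then have "y = 0\<^sub>v n"
    using det_resolvent_nonzero[OF M'] det_0_iff_vec_prod_zero_field[OF N'] y_carrier by blast
  then have "y $ j = 0" using ij by simp
  then show ?thesis using ij by (simp add: y_def)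
qed

section \<open>Friends of a node set\<close>

lemma is_friend_iff:
  assumes "A \<in> carrier_mat n n" "B \<in> carrier_mat n m" "C \<in> carrier_mat p n" "\<W> \<subseteq> {..<n}"
  shows "is_friend n m p A B C \<W> G \<longleftrightarrow> G \<in> carrier_mat m p \<and>
    (\<forall>i\<in>\<W>. \<forall>j<n. j \<notin> \<W> \<longrightarrow> (B * G * C) $$ (j, i) = A $$ (j, i))"
proof (cases "G \<in> carrier_mat m p")
  case True
  have K: "B * G * C \<in> carrier_mat n n" using assms(2,3) True by simp
  then have M: "A - B * G * C \<in> carrier_mat n n" by (rule minus_carrier_mat)
  have "(A - B * G * C) $$ (j, i) = 0 \<longleftrightarrow> (B * G * C) $$ (j, i) = A $$ (j, i)"
    if "i \<in> \<W>" "j < n" for i j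
  proof -
    have "i < n" using that assms(4) by auto
    then have "(A - B * G * C) $$ (j, i) = A $$ (j, i) - (B * G * C) $$ (j, i)"
      using K that by (intro index_minus_mat(1)) auto
    then show ?thesis by linarith
  qed
  then show ?thesis
    unfolding is_friend_def mat_maps_node_space_iff[OF M assms(4)] using True by blast
qed (auto simp: is_friend_def)

lemma friend_solves_DDPOF:
  assumes A: "A \<in> carrier_mat n n" and B: "B \<in> carrier_mat n m" and C: "C \<in> carrier_mat p n"
    and D: "canonical_cols n \<D> D" and T: "canonical_rows n \<T> T"
    and W: "\<D> \<subseteq> \<W>" "\<W> \<subseteq> {..<n} - \<T>" "\<T> \<subseteq> {..<n}"
    and G: "is_friend n m p A B C \<W> G"
  shows "solves_DDPOF n A B C D T G"
proof -
  define M where "M = A - B * G * C"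
  have Wn: "\<W> \<subseteq> {..<n}" and Dn: "\<D> \<subseteq> {..<n}" using W by auto
  have Gc: "G \<in> carrier_mat m p" using G by (simp add: is_friend_def)
  have M: "M \<in> carrier_mat n n" using A B C Gc by (simp add: M_def minus_carrier_mat)
  have inv: "M $$ (j, i) = 0" if "i \<in> \<W>" "j < n" "j \<notin> \<W>" for i j
    using G that unfolding is_friend_def M_def[symmetric] mat_maps_node_space_iff[OF M Wn] by blast
  let ?N = "rat_s \<cdot>\<^sub>m 1\<^sub>m n - rat_mat M"
  have const_diff: "to_fract [:a - b:] = to_fract [:a:] - to_fract [:b:]" for a b :: real
    by (simp flip: to_fract_diff)
  have "rat_mat (B * G * C) = rat_mat B * rat_mat G * rat_mat C"
    using rat_mat_mult[OF B Gc] rat_mat_mult[OF mult_carrier_mat[OF B Gc] C] by simp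
  moreover have "?N = rat_s \<cdot>\<^sub>m 1\<^sub>m n - rat_mat A + rat_mat (B * G * C)"
    using A B C Gc unfolding M_def
    by (intro eq_matI) (auto simp: rat_mat_def const_diff)
  ultimately have N: "?N = rat_s \<cdot>\<^sub>m 1\<^sub>m n - rat_mat A + rat_mat B * rat_mat G * rat_mat C"
    by simp
  obtain R where R: "mat_inverse ?N = Some R" "?N * R = 1\<^sub>m n" "R \<in> carrier_mat n n"
    using mat_inverse_exists[OF _ det_resolvent_nonzero[OF M]] M
    by (metis minus_carrier_mat rat_mat_carrier)
  obtain \<delta> where \<delta>: "bij_betw \<delta> {..<card \<D>} \<D>"
    "\<And>k. k < card \<D> \<Longrightarrow> col D k = unit_vec n (\<delta> k)"
    using canonical_cols_enum[OF D Dn] by metis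
  obtain \<tau> where \<tau>: "bij_betw \<tau> {..<card \<T>} \<T>"
    "\<And>k. k < card \<T> \<Longrightarrow> col (transpose_mat T) k = unit_vec n (\<tau> k)"
    using canonical_cols_enum[OF canonical_rows_transpose[OF T] W(3)] by metis
  have Dc: "D \<in> carrier_mat n (card \<D>)" and Tc: "T \<in> carrier_mat (card \<T>) n"
    using D T by (auto simp: canonical_cols_def canonical_rows_def)
  have "(rat_mat T * R * rat_mat D) $$ (k, l) = 0" if k: "k < card \<T>" and l: "l < card \<D>" for k l
  proof -
    have t: "\<tau> k \<in> \<T>" and d: "\<delta> l \<in> \<D>" using k l \<tau>(1) \<delta>(1) bij_betwE by auto
    then have tn: "\<tau> k < n" "\<tau> k \<notin> \<W>" and dn: "\<delta> l < n" "\<delta> l \<in> \<W>" using W by auto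
    have "row (rat_mat T) k = col (rat_mat (transpose_mat T)) k"
      using k Tc by (intro eq_vecI) (auto simp: rat_mat_def)
    also have "\<dots> = unit_vec n (\<tau> k)"
      using \<tau>(2)[OF k] Tc k tn by (intro rat_mat_col_unit) auto
    finally have "row (rat_mat T) k = unit_vec n (\<tau> k)" .
    moreover have "col (rat_mat D) l = unit_vec n (\<delta> l)"
      using \<delta>(2)[OF l] Dc l dn by (intro rat_mat_col_unit) auto
    ultimately have "(rat_mat T * R * rat_mat D) $$ (k, l) = R $$ (\<tau> k, \<delta> l)"
      using Tc Dc R(3) k l tn dn by (intro sandwich_unit) auto
    also have "\<dots> = 0" using resolvent_entry_zero[OF M inv R(3,2)] tn dn by blast
    finally show ?thesis .
  qed
  then have "rat_mat T * R * rat_mat D = 0\<^sub>m (dim_row T) (dim_col D)"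
    using Tc Dc by (intro eq_matI) auto
  then show ?thesis unfolding solves_DDPOF_def N[symmetric] using R(1) by blast
qed

theorem theorem11:
  fixes n m p :: nat
    and E :: "(nat \<times> nat) set"
    and A B C D T :: "real mat"
    and \<B> \<C> \<D> \<T> \<W> :: "nat set"
  assumes "weighted_digraph n E A"
    and "\<B> \<subseteq> {..<n}" and "\<C> \<subseteq> {..<n}" and "\<D> \<subseteq> {..<n}" and "\<T> \<subseteq> {..<n}"
    and "canonical_cols n \<B> B" and "canonical_rows n \<C> C"
    and "canonical_cols n \<D> D" and "canonical_rows n \<T> T"
    and "\<D> \<inter> \<T> = {}" and "\<D> \<inter> \<B> = {}" and "\<T> \<inter> \<C> = {}"
    and "m = card \<B>" and "p = card \<C>"
    and "\<W> \<subseteq> {..<n}"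
    and "AB_invariant n A \<B> \<W>" and "CA_invariant n \<C> A \<W>"
    and "\<C> = in_boundary E \<W>" and "\<B> = out_boundary E \<W>"
  shows "is_friend n m p A B C \<W> (transpose_mat B * A * transpose_mat C) \<and>
    (\<forall>G. is_friend n m p A B C \<W> G \<longrightarrow> G = transpose_mat B * A * transpose_mat C) \<and>
    (\<D> \<subseteq> \<W> \<and> \<W> \<subseteq> {..<n} - \<T> \<longrightarrow>
       solves_DDPOF n A B C D T (transpose_mat B * A * transpose_mat C))"
proof -
  let ?G = "transpose_mat B * A * transpose_mat C"
  have A: "A \<in> carrier_mat n n" and
    edge: "\<And>i j. i < n \<Longrightarrow> j < n \<Longrightarrow> A $$ (j, i) \<noteq> 0 \<Longrightarrow> (i, j) \<in> E"
    using assms(1) by (auto simp: weighted_digraph_def)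
  have B: "B \<in> carrier_mat n m" and C: "C \<in> carrier_mat p n"
    using assms(6,7,13,14) by (auto simp: canonical_cols_def canonical_rows_def)
  have Gc: "?G \<in> carrier_mat m p" using A B C by simp
  have CW: "\<C> \<subseteq> \<W>" and BW: "\<B> \<inter> \<W> = {}"
    using assms(18,19) by (auto simp: in_boundary_def out_boundary_def)
  obtain \<beta> where \<beta>: "bij_betw \<beta> {..<m} \<B>"
    "\<And>k. k < m \<Longrightarrow> col B k = unit_vec n (\<beta> k)"
    "\<And>k. k < m \<Longrightarrow> row B (\<beta> k) = unit_vec m k"
    "\<And>j. j < n \<Longrightarrow> j \<notin> \<B> \<Longrightarrow> row B j = 0\<^sub>v m"
    using canonical_cols_enum[OF assms(6,2)] assms(13) by metis
  obtain \<gamma> where \<gamma>: "bij_betw \<gamma> {..<p} \<C>"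
    "\<And>l. l < p \<Longrightarrow> col (transpose_mat C) l = unit_vec n (\<gamma> l)"
    "\<And>l. l < p \<Longrightarrow> row (transpose_mat C) (\<gamma> l) = unit_vec p l"
    "\<And>i. i < n \<Longrightarrow> i \<notin> \<C> \<Longrightarrow> row (transpose_mat C) i = 0\<^sub>v p"
    using canonical_cols_enum[OF canonical_rows_transpose[OF assms(7)] assms(3)] assms(14) by metis
  have \<beta>_in: "\<beta> k \<in> \<B>" "\<beta> k < n" if "k < m" for k
    using bij_betwE[OF \<beta>(1)] that assms(2) by auto
  have \<gamma>_in: "\<gamma> l \<in> \<C>" "\<gamma> l < n" if "l < p" for l
    using bij_betwE[OF \<gamma>(1)] that assms(3) by auto
  have G_entry: "?G $$ (k, l) = A $$ (\<beta> k, \<gamma> l)" if k: "k < m" and l: "l < p" for k l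
    using A B C k l \<beta>(2) \<gamma>(2) \<beta>_in \<gamma>_in by (intro sandwich_unit) auto
  have BHC_entry: "(B * H * C) $$ (\<beta> k, \<gamma> l) = H $$ (k, l)"
    if "H \<in> carrier_mat m p" and k: "k < m" and l: "l < p" for H k l
    using that B C \<beta>(3)[OF k] \<gamma>(3)[OF l] \<beta>_in[OF k] \<gamma>_in[OF l] by (intro sandwich_unit) auto
  have friend: "is_friend n m p A B C \<W> ?G"
    unfolding is_friend_iff[OF A B C assms(15)]
  proof (intro conjI ballI allI impI Gc)
    fix i j assume i: "i \<in> \<W>" and j: "j < n" "j \<notin> \<W>"
    have i_n: "i < n" using i assms(15) by auto
    show "(B * ?G * C) $$ (j, i) = A $$ (j, i)"
    proof (cases "j \<in> \<B> \<and> i \<in> \<C>")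
      case True
      then obtain k l where "k < m" "j = \<beta> k" "l < p" "i = \<gamma> l"
        using \<beta>(1) \<gamma>(1) by (auto simp: bij_betw_def)
      then show ?thesis using BHC_entry[OF Gc] G_entry by simp
    next
      case False
      then have "row B j = 0\<^sub>v m \<or> col C i = 0\<^sub>v p"
        using \<beta>(4)[of j] \<gamma>(4)[of i] i_n j C by auto
      then have "(B * ?G * C) $$ (j, i) = 0"
        by (intro sandwich_zero[OF B Gc C j(1) i_n])
      \<comment> \<open>An edge from \<open>i\<close> to \<open>j\<close> would leave \<open>\<W>\<close> and so put its ends into both boundaries.\<close>
      moreover have "A $$ (j, i) = 0"
        using False edge[OF i_n j(1)] i j assms(18,19)
        by (auto simp: in_boundary_def out_boundary_def)
      ultimately show ?thesis by simp
    qed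
  qed
  have unique: "H = ?G" if H: "is_friend n m p A B C \<W> H" for H
  proof -
    have Hc: "H \<in> carrier_mat m p" and
      H_entry: "\<And>i j. i \<in> \<W> \<Longrightarrow> j < n \<Longrightarrow> j \<notin> \<W> \<Longrightarrow> (B * H * C) $$ (j, i) = A $$ (j, i)"
      using H unfolding is_friend_iff[OF A B C assms(15)] by auto
    have "H $$ (k, l) = ?G $$ (k, l)" if k: "k < m" and l: "l < p" for k l
    proof -
      have "H $$ (k, l) = (B * H * C) $$ (\<beta> k, \<gamma> l)" using BHC_entry[OF Hc k l] by simp
      also have "\<dots> = A $$ (\<beta> k, \<gamma> l)"
        using \<beta>_in[OF k] \<gamma>_in[OF l] CW BW by (intro H_entry) auto
      finally show ?thesis using G_entry[OF k l] by simp
    qed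
    then show ?thesis using Hc Gc by (metis carrier_matD eq_matI)
  qed
  have "solves_DDPOF n A B C D T ?G" if "\<D> \<subseteq> \<W> \<and> \<W> \<subseteq> {..<n} - \<T>"
    using friend_solves_DDPOF[OF A B C assms(8,9) _ _ assms(5) friend] that by blast
  then show ?thesis by (intro conjI allI impI friend unique)
qed

end
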